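(* Consider the weighted harmonic interface scheme (defined in the context) for the interface problem with jump conditions $[u]_\alpha=w$, $[\beta u_x]_\alpha=v$. If $$u^-\in C^3([x_{I-1},\alpha]),\qquad u^+\in C^3([\alpha,x_{I+2}]),$$ then, as $h\to0$, $$\tau_I=O(1),\qquad \tau_{I+1}=O(1),\qquad \tau_I+\tau_{I+1}=O(h).$$
   Context: Interface problem: let $a<\alpha<b$, $\beta(x)=\beta^->0$ for $x<\alpha$ and $\beta(x)=\beta^+>0$ for $x>\alpha$ (constants). The function $u$ satisfies $-(\beta u_x)_x=f$ on $(a,\alpha)\cup(\alpha,b)$, $u(a)=u(b)=0$, with $[u]_\alpha=w$ and $[\beta u_x]_\alpha=v$, where $[g]_\alpha:=g(\alpha^+)-g(\alpha^-)$. $u^-$ and $u^+$ denote the restrictions of $u$ to the left and right of $\alpha$, extended to $\alpha$ by one-sided limits. Grid: $x_i=a+ih$, $0\le i\le n+1$, $h=(b-a)/(n+1)$, $x_{i\pm\frac12}=x_i\pm h/2$; the interface lies strictly between two grid points, $x_I<\alpha<x_{I+1}$, with $1\le I\le n-1$. Set $\delta_\ell=\alpha-x_I$, $\delta_r=x_{I+1}-\alpha$, $h_\ell=\delta_\ell+h/2$, $h_r=\delta_r+h/2$. Weighted harmonic scheme: face coefficients $\beta_{i+\frac12}=\beta^-$ for $i<I$, $\beta_{i+\frac12}=\beta^+$ for $i>I$, and on the cut interval $$\beta_{I+\frac12}=\widehat\beta_H=\left(\frac{\delta_\ell}{\beta^-h}+\frac{\delta_r}{\beta^+h}\right)^{-1}.$$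 The discrete operator is $$(L_hU)_i=\frac1{h^2}\left[-\beta_{i-\frac12}U_{i-1}+(\beta_{i-\frac12}+\beta_{i+\frac12})U_i-\beta_{i+\frac12}U_{i+1}\right],\quad 1\le i\le n,\quad U_0=U_{n+1}=0,$$ and the scheme is $L_hU=r_h$ with $r_i^h=f(x_i)$ for $i\ne I,I+1$ and $$r_I^h=\frac{h_\ell}{h}\bigl(f(x_I)+C_I\bigr),\qquad r_{I+1}^h=\frac{h_r}{h}\bigl(f(x_{I+1})+C_{I+1}\bigr),$$ $$C_I=-\frac{\widehat\beta_H}{h_\ell h}\left(w+\frac{v}{\beta^+}\delta_r\right),\qquad C_{I+1}=\frac{\widehat\beta_H}{h_rh}\left(w-\frac{v}{\beta^-}\delta_\ell\right).$$ The truncation error is $\tau:=L_hu_h-r_h$, where $u_h=(u(x_1),\ldots,u(x_n))^T$. The notation $O(h^k)$ means bounded in absolute value by $Ch^k$ as $h\to0$ (with $\alpha$ and $u$ fixed, $I$ depending on $h$), with $C$ independent of $h$. *)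

theory Defs
  imports "HOL-Analysis.Analysis" "HOL-Library.Landau_Symbols"
begin

section \<open>The interface problem\<close>

definition pw_coeff :: "real \<Rightarrow> real \<Rightarrow> real \<Rightarrow> real \<Rightarrow> real" where
  "pw_coeff \<alpha> \<beta>m \<beta>p x = (if x < \<alpha> then \<beta>m else \<beta>p)"

text \<open>\<open>has_jump g \<alpha> s\<close>: both one-sided limits of \<open>g\<close> at \<open>\<alpha>\<close> exist and $[g]_\alpha = s$.
  The value of \<open>g\<close> at \<open>\<alpha>\<close> itself plays no role.\<close>

definition has_jump :: "(real \<Rightarrow> real) \<Rightarrow> real \<Rightarrow> real \<Rightarrow> bool" where
  "has_jump g \<alpha> s \<longleftrightarrow>
     (\<exists>gl gr. (g \<longlongrightarrow> gl) (at_left \<alpha>) \<and> (g \<longlongrightarrow> gr) (at_right \<alpha>) \<and> gr - gl = s)"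

definition solves_interface_problem ::
  "real \<Rightarrow> real \<Rightarrow> real \<Rightarrow> real \<Rightarrow> real \<Rightarrow> real \<Rightarrow> real \<Rightarrow> (real \<Rightarrow> real) \<Rightarrow> (real \<Rightarrow> real) \<Rightarrow> bool" where
  "solves_interface_problem a b \<alpha> \<beta>m \<beta>p w v f u \<longleftrightarrow>
     (\<forall>x \<in> {a<..<\<alpha>} \<union> {\<alpha><..<b}.
        u differentiable (at x) \<and>
        ((\<lambda>y. pw_coeff \<alpha> \<beta>m \<beta>p y * deriv u y) has_real_derivative - f x) (at x)) \<and>
     u a = 0 \<and> u b = 0 \<and>
     has_jump u \<alpha> w \<and>
     has_jump (\<lambda>y. pw_coeff \<alpha> \<beta>m \<beta>p y * deriv u y) \<alpha> v"

text \<open>The one-sided branches $u^-$ and $u^+$, extended to \<open>\<alpha>\<close> by one-sided limits.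
  Only their values on the left, respectively on the right, of \<open>\<alpha>\<close> matter.\<close>

definition left_branch :: "real \<Rightarrow> (real \<Rightarrow> real) \<Rightarrow> real \<Rightarrow> real" where
  "left_branch \<alpha> u x = (if x = \<alpha> then Lim (at_left \<alpha>) u else u x)"

definition right_branch :: "real \<Rightarrow> (real \<Rightarrow> real) \<Rightarrow> real \<Rightarrow> real" where
  "right_branch \<alpha> u x = (if x = \<alpha> then Lim (at_right \<alpha>) u else u x)"

text \<open>Membership in $C^k(S)$ for an interval \<open>S\<close>; derivatives at the endpoints contained
  in \<open>S\<close> are one-sided.\<close>

definition C_class_on :: "nat \<Rightarrow> real set \<Rightarrow> (real \<Rightarrow> real) \<Rightarrow> bool" where
  "C_class_on k S g \<longleftrightarrow>
     (\<exists>D :: nat \<Rightarrow> real \<Rightarrow> real.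
        (\<forall>x\<in>S. D 0 x = g x) \<and>
        (\<forall>j<k. \<forall>x\<in>S. (D j has_real_derivative D (Suc j) x) (at x within S)) \<and>
        continuous_on S (D k))"


section \<open>The grids\<close>

definition mesh :: "real \<Rightarrow> real \<Rightarrow> nat \<Rightarrow> real" where
  "mesh a b n = (b - a) / (real n + 1)"

definition node :: "real \<Rightarrow> real \<Rightarrow> nat \<Rightarrow> nat \<Rightarrow> real" where
  "node a b n i = a + real i * mesh a b n"

definition is_cut_index :: "real \<Rightarrow> real \<Rightarrow> real \<Rightarrow> nat \<Rightarrow> nat \<Rightarrow> bool" where
  "is_cut_index a b \<alpha> n i \<longleftrightarrow>
     1 \<le> i \<and> i + 1 \<le> n \<and> node a b n i < \<alpha> \<and> \<alpha> < node a b n (i + 1)"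

definition cut_index :: "real \<Rightarrow> real \<Rightarrow> real \<Rightarrow> nat \<Rightarrow> nat" where
  "cut_index a b \<alpha> n = (THE i. is_cut_index a b \<alpha> n i)"

text \<open>The limit \<open>h \<rightarrow> 0\<close>, i.e.\ \<open>n \<rightarrow> \<infinity>\<close>, along all admissible grids: those for which
  \<open>\<alpha>\<close> lies strictly between two neighbouring nodes with interior index range.\<close>

definition interface_grids :: "real \<Rightarrow> real \<Rightarrow> real \<Rightarrow> nat filter" where
  "interface_grids a b \<alpha> = inf at_top (principal {n. \<exists>i. is_cut_index a b \<alpha> n i})"


section \<open>The weighted harmonic scheme\<close>

definition delta_l :: "real \<Rightarrow> real \<Rightarrow> real \<Rightarrow> nat \<Rightarrow> real" where
  "delta_l a b \<alpha> n = \<alpha> - node a b n (cut_index a b \<alpha> n)"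

definition delta_r :: "real \<Rightarrow> real \<Rightarrow> real \<Rightarrow> nat \<Rightarrow> real" where
  "delta_r a b \<alpha> n = node a b n (cut_index a b \<alpha> n + 1) - \<alpha>"

definition h_l :: "real \<Rightarrow> real \<Rightarrow> real \<Rightarrow> nat \<Rightarrow> real" where
  "h_l a b \<alpha> n = delta_l a b \<alpha> n + mesh a b n / 2"

definition h_r :: "real \<Rightarrow> real \<Rightarrow> real \<Rightarrow> nat \<Rightarrow> real" where
  "h_r a b \<alpha> n = delta_r a b \<alpha> n + mesh a b n / 2"

definition beta_H :: "real \<Rightarrow> real \<Rightarrow> real \<Rightarrow> real \<Rightarrow> real \<Rightarrow> nat \<Rightarrow> real" where
  "beta_H a b \<alpha> \<beta>m \<beta>p n =
     inverse (delta_l a b \<alpha> n / (\<beta>m * mesh a b n) + delta_r a b \<alpha> n / (\<beta>p * mesh a b n))"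

text \<open>\<open>face_coeff \<dots> i\<close> is $\beta_{i+1/2}$; hence $\beta_{i-1/2}$ is \<open>face_coeff \<dots> (i - 1)\<close>.\<close>

definition face_coeff :: "real \<Rightarrow> real \<Rightarrow> real \<Rightarrow> real \<Rightarrow> real \<Rightarrow> nat \<Rightarrow> nat \<Rightarrow> real" where
  "face_coeff a b \<alpha> \<beta>m \<beta>p n i =
     (if i < cut_index a b \<alpha> n then \<beta>m
      else if i = cut_index a b \<alpha> n then beta_H a b \<alpha> \<beta>m \<beta>p n
      else \<beta>p)"

text \<open>A grid function is given by its values at the indices \<open>1, \<dots>, n\<close>; it is extended by
  $U_0 = U_{n+1} = 0$.\<close>

definition zero_ext :: "nat \<Rightarrow> (nat \<Rightarrow> real) \<Rightarrow> nat \<Rightarrow> real" where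
  "zero_ext n U i = (if 1 \<le> i \<and> i \<le> n then U i else 0)"

text \<open>Meaningful for \<open>1 \<le> i \<le> n\<close>.\<close>

definition discrete_op ::
  "real \<Rightarrow> real \<Rightarrow> real \<Rightarrow> real \<Rightarrow> real \<Rightarrow> nat \<Rightarrow> (nat \<Rightarrow> real) \<Rightarrow> nat \<Rightarrow> real" where
  "discrete_op a b \<alpha> \<beta>m \<beta>p n U i =
     (let \<beta> = face_coeff a b \<alpha> \<beta>m \<beta>p n; V = zero_ext n U in
      1 / (mesh a b n)\<^sup>2 *
        (- \<beta> (i - 1) * V (i - 1) + (\<beta> (i - 1) + \<beta> i) * V i - \<beta> i * V (i + 1)))"

definition corr_l ::
  "real \<Rightarrow> real \<Rightarrow> real \<Rightarrow> real \<Rightarrow> real \<Rightarrow> real \<Rightarrow> real \<Rightarrow> nat \<Rightarrow> real" where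
  "corr_l a b \<alpha> \<beta>m \<beta>p w v n =
     - (beta_H a b \<alpha> \<beta>m \<beta>p n / (h_l a b \<alpha> n * mesh a b n)) * (w + v / \<beta>p * delta_r a b \<alpha> n)"

definition corr_r ::
  "real \<Rightarrow> real \<Rightarrow> real \<Rightarrow> real \<Rightarrow> real \<Rightarrow> real \<Rightarrow> real \<Rightarrow> nat \<Rightarrow> real" where
  "corr_r a b \<alpha> \<beta>m \<beta>p w v n =
     beta_H a b \<alpha> \<beta>m \<beta>p n / (h_r a b \<alpha> n * mesh a b n) * (w - v / \<beta>m * delta_l a b \<alpha> n)"

definition scheme_rhs ::
  "real \<Rightarrow> real \<Rightarrow> real \<Rightarrow> real \<Rightarrow> real \<Rightarrow> real \<Rightarrow> real \<Rightarrow> (real \<Rightarrow> real) \<Rightarrow> nat \<Rightarrow> nat \<Rightarrow> real" where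
  "scheme_rhs a b \<alpha> \<beta>m \<beta>p w v f n i =
     (let c = cut_index a b \<alpha> n in
      if i = c then h_l a b \<alpha> n / mesh a b n * (f (node a b n i) + corr_l a b \<alpha> \<beta>m \<beta>p w v n)
      else if i = c + 1 then h_r a b \<alpha> n / mesh a b n * (f (node a b n i) + corr_r a b \<alpha> \<beta>m \<beta>p w v n)
      else f (node a b n i))"

definition trunc_err ::
  "real \<Rightarrow> real \<Rightarrow> real \<Rightarrow> real \<Rightarrow> real \<Rightarrow> real \<Rightarrow> real \<Rightarrow> (real \<Rightarrow> real) \<Rightarrow> (real \<Rightarrow> real) \<Rightarrow> nat \<Rightarrow> nat \<Rightarrow> real" where
  "trunc_err a b \<alpha> \<beta>m \<beta>p w v f u n i =
     discrete_op a b \<alpha> \<beta>m \<beta>p n (\<lambda>j. u (node a b n j)) i - scheme_rhs a b \<alpha> \<beta>m \<beta>p w v f n i"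


section \<open>Well-definedness of the cut index and of the limit\<close>

lemma is_cut_index_unique:
  assumes "a < b" "is_cut_index a b \<alpha> n i" "is_cut_index a b \<alpha> n j"
  shows "i = j"
proof -
  have h: "mesh a b n > 0" using assms(1) by (simp add: mesh_def)
  have le: "k \<le> l" if "is_cut_index a b \<alpha> n k" "is_cut_index a b \<alpha> n l" for k l
  proof -
    have "real k * mesh a b n < real (l + 1) * mesh a b n"
      using that unfolding is_cut_index_def node_def by linarith
    then have "real k < real (l + 1)" using h by (simp only: mult_less_cancel_right_pos)
    then show ?thesis by simp
  qed
  show ?thesis using le assms(2,3) by (simp add: le_antisym)
qed

lemma is_cut_index_cut_index:
  assumes "a < b" "\<exists>i. is_cut_index a b \<alpha> n i"
  shows "is_cut_index a b \<alpha> n (cut_index a b \<alpha> n)"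
  unfolding cut_index_def using assms is_cut_index_unique by (metis theI)

text \<open>Every sufficiently fine grid not having \<open>\<alpha>\<close> as a node is admissible.\<close>

lemma eventually_admissible:
  assumes "a < \<alpha>" "\<alpha> < b"
  shows "\<forall>\<^sub>F n in sequentially. (\<exists>i. is_cut_index a b \<alpha> n i) \<or> (\<exists>i. node a b n i = \<alpha>)"
proof -
  define d where "d = min (\<alpha> - a) (b - \<alpha>)"
  have d: "d > 0" using assms by (simp add: d_def)
  have "(\<lambda>n. (b - a) / real (Suc n)) \<longlonglongrightarrow> 0"
    using tendsto_mult_right_zero[OF LIMSEQ_inverse_real_of_nat, of "b - a"]
    by (simp add: divide_inverse)
  then have "\<forall>\<^sub>F n in sequentially. (b - a) / real (Suc n) < d"
    by (rule order_tendstoD(2)) (use d in simp)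
  then show ?thesis
  proof eventually_elim
    case (elim n)
    define h where "h = mesh a b n"
    have h: "h > 0" using assms by (simp add: h_def mesh_def)
    have hd: "h < \<alpha> - a" "h < b - \<alpha>"
      using elim by (simp_all add: h_def mesh_def d_def add.commute)
    have tot: "real (n + 1) * h = b - a" by (simp add: h_def mesh_def add.commute)
    define i where "i = nat \<lfloor>(\<alpha> - a) / h\<rfloor>"
    have ri: "real i = of_int \<lfloor>(\<alpha> - a) / h\<rfloor>"
      using assms h by (simp add: i_def)
    have "real i \<le> (\<alpha> - a) / h" "(\<alpha> - a) / h < real i + 1"
      unfolding ri by linarith+
    then have lo: "real i * h \<le> \<alpha> - a" and up: "\<alpha> - a < (real i + 1) * h"
      using h by (simp_all add: pos_le_divide_eq pos_divide_less_eq)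
    have "1 * h < (real i + 1) * h" using up hd by linarith
    then have "1 < real i + 1" using h by (simp only: mult_less_cancel_right_pos)
    then have i1: "1 \<le> i" by simp
    have "(real i + 1) * h < real (n + 1) * h"
      using lo hd tot by (simp add: distrib_right)
    then have "real i + 1 < real (n + 1)" using h by (simp only: mult_less_cancel_right_pos)
    then have i2: "i + 1 \<le> n" by simp
    show ?case
    proof (cases "node a b n i = \<alpha>")
      case False
      then have "is_cut_index a b \<alpha> n i"
        using i1 i2 lo up unfolding is_cut_index_def node_def h_def[symmetric]
        by (auto simp: algebra_simps)
      then show ?thesis by blast
    qed blast
  qed
qed

lemma interface_grids_nontrivial:
  assumes "a < \<alpha>" "\<alpha> < b"
  shows "interface_grids a b \<alpha> \<noteq> bot"
proof
  assume "interface_grids a b \<alpha> = bot"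
  then have "eventually (\<lambda>_. False) (interface_grids a b \<alpha>)" by simp
  then have "\<forall>\<^sub>F n in sequentially. \<not> (\<exists>i. is_cut_index a b \<alpha> n i)"
    by (simp add: interface_grids_def eventually_inf_principal)
  with eventually_admissible[OF assms]
  have "\<forall>\<^sub>F n in sequentially. \<exists>i. node a b n i = \<alpha>"
    by eventually_elim blast
  then obtain N where N: "\<And>n. n \<ge> N \<Longrightarrow> \<exists>i. node a b n i = \<alpha>"
    by (auto simp: eventually_sequentially)
  obtain i where i: "node a b N i = \<alpha>" using N by blast
  obtain j where j: "node a b (Suc N) j = \<alpha>" using N[of "Suc N"] by auto
  define m where "m = Suc N"
  have ei: "real i * (b - a) = (\<alpha> - a) * real m"
    using i by (simp add: node_def mesh_def m_def field_simps)
  have ej: "real j * (b - a) = (\<alpha> - a) * real (Suc m)"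
    using j by (simp add: node_def mesh_def m_def field_simps)
  have "real i * real (Suc m) * (b - a) = real j * real m * (b - a)"
    using ei ej by (metis mult.assoc mult.commute)
  then have "real (i * Suc m) = real (j * m)" using assms by (simp only: of_nat_mult mult_cancel_right) auto
  then have eq: "i * Suc m = j * m" by (simp only: of_nat_eq_iff)
  then have "m dvd i * Suc m" by simp
  then have "m dvd i" by (simp add: coprime_dvd_mult_left_iff)
  moreover have "0 < i"
  proof (rule ccontr)
    assume "\<not> 0 < i"
    with ei show False using assms by (simp add: m_def)
  qed
  moreover have "i < m"
  proof -
    have "real i * (b - a) < real m * (b - a)"
      using ei assms by (simp add: m_def mult.commute)
    then show ?thesis using assms by simp
  qed
  ultimately show False using dvd_imp_le by fastforce
qed

end

theory Submission
  imports Defs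
begin

text \<open>Write \<open>p\<^sub>k\<close> and \<open>q\<^sub>k\<close> for the one-sided \<open>k\<close>-th derivatives of \<open>u\<close> at \<open>\<alpha>\<close> from the left and
  from the right, and \<open>H\<close> for the harmonic coefficient on the cut interval. Near the interface the
  scheme fails to be consistent only through the curvature of \<open>u\<close> inside the cut interval: with
    \<open>T = H (q\<^sub>2 \<delta>\<^sub>r\<^sup>2 - p\<^sub>2 \<delta>\<^sub>l\<^sup>2) / (2 h\<^sup>2)\<close>
  one has \<open>\<tau>\<^sub>I = - T + O(h)\<close> and \<open>\<tau>\<^sub>I\<^sub>+\<^sub>1 = T + O(h)\<close>. Since \<open>0 < H \<le> \<beta>m + \<beta>p\<close> and both
  \<open>\<delta>\<^sub>l, \<delta>\<^sub>r\<close> are at most \<open>h\<close>, \<open>T\<close> is bounded, which gives the two \<open>O(1)\<close> bounds; and \<open>T\<close> cancels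
  in the sum, because it stems from the discrete flux through the one face shared by both cells.

  The expansion at \<open>x\<^sub>I\<close> (\<open>cut_residual_expansion\<close>) goes as follows. The correction term subtracts
  \<open>w + v \<delta>\<^sub>r / \<beta>p\<close> from \<open>u(x\<^sub>I\<^sub>+\<^sub>1) - u(x\<^sub>I)\<close>. After inserting the jump conditions
  \<open>w = q\<^sub>0 - p\<^sub>0\<close>, \<open>v = \<beta>p q\<^sub>1 - \<beta>m p\<^sub>1\<close>, what remains is
    \<open>p\<^sub>1 (\<delta>\<^sub>l + \<beta>m \<delta>\<^sub>r / \<beta>p) + (q\<^sub>2 \<delta>\<^sub>r\<^sup>2 - p\<^sub>2 \<delta>\<^sub>l\<^sup>2) / 2 + O(h\<^sup>3)\<close>,
  and the harmonic weight is exactly the one for which \<open>H (\<delta>\<^sub>l + \<beta>m \<delta>\<^sub>r / \<beta>p) = h \<beta>m\<close>. So the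
  first-order part matches that of the difference quotient over \<open>[x\<^sub>I\<^sub>-\<^sub>1, x\<^sub>I]\<close>. The second-order part
  of that quotient is cancelled by the source, since \<open>f = - \<beta>m u''\<close> on the left and the source is
  weighted by \<open>h\<^sub>l / h\<close>, where \<open>h\<^sub>l = \<delta>\<^sub>l + h / 2\<close> is the distance from \<open>\<alpha>\<close> to the midpoint of
  \<open>[x\<^sub>I\<^sub>-\<^sub>1, x\<^sub>I]\<close>. The expansion at \<open>x\<^sub>I\<^sub>+\<^sub>1\<close> is the same statement after reflection about \<open>\<alpha>\<close>.

  The constants are uniform because the third derivatives are bounded on one fixed neighbourhood of
  \<open>\<alpha>\<close>, taken from a single admissible grid; the four nodes next to the interface lie inside it as soon as
  the mesh is fine enough.\<close>

section \<open>The two branches as smooth functions\<close>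

text \<open>Passing to a compact subset \<open>S'\<close> replaces the grid-dependent interval of the smoothness assumption
  by one that does not depend on the grid, with a bound on the third derivative there.\<close>

lemma C3_bounded_data:
  assumes "C_class_on 3 S g" and S': "S' \<subseteq> S" "compact S'"
  obtains D M where "\<forall>x\<in>S'. D 0 x = g x"
    and "\<forall>j<3. \<forall>x\<in>S'. (D j has_real_derivative D (Suc j) x) (at x within S')"
    and "\<forall>x\<in>S'. \<bar>D 3 x\<bar> \<le> M"
proof -
  obtain D where D: "\<forall>x\<in>S. D 0 x = g x" "continuous_on S (D 3)"
    "\<forall>j<3. \<forall>x\<in>S. (D j has_real_derivative D (Suc j) x) (at x within S)"
    using assms(1) unfolding C_class_on_def by blast
  have "bounded (D 3 ` S')"
    using D(2) S' by (meson compact_continuous_image compact_imp_bounded continuous_on_subset)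
  then obtain M where M: "\<And>x. x \<in> S' \<Longrightarrow> \<bar>D 3 x\<bar> \<le> M"
    unfolding bounded_iff by (metis imageI real_norm_def)
  have "(D j has_real_derivative D (Suc j) x) (at x within S')" if "j < 3" "x \<in> S'" for j x
    using D(3) that S'(1) DERIV_subset by blast
  then show ?thesis using D(1) S'(1) M by (intro that[of D M]) auto
qed

text \<open>The family \<open>D\<close> witnesses the smoothness of one branch on the closed one-sided neighbourhood \<open>S\<close>
  of the interface, whereas the differential equation speaks about \<open>deriv u\<close> and is available only
  on the open part \<open>T\<close>. There both agree, so that the equation becomes \<open>f = - \<beta> D\<^sub>2\<close>.\<close>

lemma branch_at_interior_points:
  assumes D: "\<forall>j<3. \<forall>x\<in>S. (D j has_real_derivative D (Suc j) x) (at x within S)"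
    and T: "open T" "T \<subseteq> S"
    and u: "\<forall>x\<in>T. D 0 x = u x"
    and c: "\<forall>x\<in>T. c x = \<beta>"
    and x: "x \<in> T"
  shows flux_on_branch: "c x * deriv u x = \<beta> * D 1 x"
    and source_on_branch:
      "((\<lambda>y. c y * deriv u y) has_real_derivative - g) (at x) \<Longrightarrow> g = - \<beta> * D 2 x"
proof -
  have at: "(D j has_real_derivative D (Suc j) y) (at y)" if "j < 3" "y \<in> T" for j y
    using D that T by (metis at_within_open_subset subsetD)
  have flux: "c y * deriv u y = \<beta> * D 1 y" if y: "y \<in> T" for y
  proof -
    have "(u has_real_derivative D (Suc 0) y) (at y)"
      by (rule has_field_derivative_transform_within_open[OF at[OF _ y]]) (use T u y in auto)
    then show ?thesis using c y by (simp add: DERIV_imp_deriv)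
  qed
  then show "c x * deriv u x = \<beta> * D 1 x" using x .
  assume g: "((\<lambda>y. c y * deriv u y) has_real_derivative - g) (at x)"
  have "((\<lambda>y. \<beta> * D 1 y) has_real_derivative - g) (at x)"
    by (rule has_field_derivative_transform_within_open[OF g T(1) x]) (simp add: flux)
  moreover have "((\<lambda>y. \<beta> * D 1 y) has_real_derivative \<beta> * D 2 x) (at x)"
    using at[of 1 x] x by (auto intro!: DERIV_cmult simp: numeral_2_eq_2)
  ultimately have "- g = \<beta> * D 2 x" by (rule DERIV_unique)
  then show "g = - \<beta> * D 2 x" by simp
qed

text \<open>Here \<open>z\<close> is meant to be the interface, an endpoint of \<open>S\<close> outside \<open>T\<close>. The limits of \<open>u\<close> and of
  the flux are then determined by the values of \<open>D\<close> at \<open>z\<close>, which turns the jump conditions into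
  equations between Taylor coefficients.\<close>

lemma branch_limits:
  assumes D: "\<forall>j<3. \<forall>x\<in>S. (D j has_real_derivative D (Suc j) x) (at x within S)"
    and T: "open T" "T \<subseteq> S" and z: "z \<in> S"
    and u: "\<forall>x\<in>T. D 0 x = u x"
    and c: "\<forall>x\<in>T. c x = \<beta>"
  shows "(u \<longlongrightarrow> D 0 z) (at z within T)"
    and "((\<lambda>y. c y * deriv u y) \<longlongrightarrow> \<beta> * D 1 z) (at z within T)"
proof -
  have cont: "(D j \<longlongrightarrow> D j z) (at z within T)" if "j < 3" for j
    using DERIV_continuous[of "D j" _ z S] D that z T(2) tendsto_within_subset
    unfolding continuous_within by blast
  have "\<forall>\<^sub>F y in at z within T. D 0 y = u y"
    unfolding eventually_at_filter using u by simp
  then show "(u \<longlongrightarrow> D 0 z) (at z within T)"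
    using cont[of 0] tendsto_cong by fastforce
  have *: "((\<lambda>y. \<beta> * D 1 y) \<longlongrightarrow> \<beta> * D 1 z) (at z within T)"
    by (intro tendsto_intros cont) simp
  have "\<beta> * D 1 y = c y * deriv u y" if "y \<in> T" for y
    using flux_on_branch[OF D T u c that] by simp
  then have ev: "\<forall>\<^sub>F y in at z within T. \<beta> * D 1 y = c y * deriv u y"
    unfolding eventually_at_filter by (simp add: always_eventually)
  show "((\<lambda>y. c y * deriv u y) \<longlongrightarrow> \<beta> * D 1 z) (at z within T)"
    using * tendsto_cong[OF ev] by blast
qed

lemma jump_of_limits:
  assumes "has_jump g \<alpha> s" "(g \<longlongrightarrow> l) (at_left \<alpha>)" "(g \<longlongrightarrow> r) (at_right \<alpha>)"
  shows "r = l + s"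
proof -
  obtain gl gr where "(g \<longlongrightarrow> gl) (at_left \<alpha>)" "(g \<longlongrightarrow> gr) (at_right \<alpha>)" "gr - gl = s"
    using assms(1) unfolding has_jump_def by blast
  moreover from this have "gl = l" "gr = r"
    using assms(2,3) tendsto_unique trivial_limit_at_left_real trivial_limit_at_right_real by metis+
  ultimately show ?thesis by simp
qed

text \<open>Allowing \<open>t\<close> of either sign serves the branches on both sides of \<open>z\<close> at once.\<close>

lemma branch_taylor:
  fixes D :: "nat \<Rightarrow> real \<Rightarrow> real"
  assumes D: "\<forall>j<3. \<forall>x\<in>S. (D j has_real_derivative D (Suc j) x) (at x within S)"
    and S: "convex S" and M: "\<forall>x\<in>S. \<bar>D 3 x\<bar> \<le> M" and z: "z \<in> S" "z + t \<in> S"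
  shows "\<bar>D 0 (z + t) - (D 0 z + D 1 z * t + D 2 z * t\<^sup>2 / 2)\<bar> \<le> M * \<bar>t\<bar> ^ 3 / 2"
    and "\<bar>D 2 (z + t) - D 2 z\<bar> \<le> M * \<bar>t\<bar>"
proof -
  have "norm (D 0 (z + t) - (\<Sum>i\<le>2. D i z * ((z + t) - z) ^ i / fact i))
          \<le> M * norm ((z + t) - z) ^ Suc 2 / fact 2"
    by (rule field_Taylor[OF S]) (use D M z in \<open>auto simp: eval_nat_numeral\<close>)
  then show "\<bar>D 0 (z + t) - (D 0 z + D 1 z * t + D 2 z * t\<^sup>2 / 2)\<bar> \<le> M * \<bar>t\<bar> ^ 3 / 2"
    by (simp add: eval_nat_numeral add.assoc)
  have "norm (D (2 + 0) (z + t) - (\<Sum>i\<le>0. D (2 + i) z * ((z + t) - z) ^ i / fact i))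
          \<le> M * norm ((z + t) - z) ^ Suc 0 / fact 0"
    by (rule field_Taylor[OF S, where f = "\<lambda>i. D (2 + i)"])
       (use D M z in \<open>auto simp: eval_nat_numeral\<close>)
  then show "\<bar>D 2 (z + t) - D 2 z\<bar> \<le> M * \<bar>t\<bar>" by simp
qed

section \<open>The residual next to the interface\<close>

text \<open>The truncation error at a node adjacent to the interface, described from that node's own side:
  \<open>B\<close> and \<open>d\<close> are the coefficient and the distance to the interface on its side, \<open>B'\<close> and \<open>d'\<close> those
  on the opposite side, and \<open>u0\<close>, \<open>u1\<close>, \<open>u2\<close> are the values at its neighbour away from the interface,
  at itself and across the interface. Orienting the formula this way makes the two nodes instances
  of it: reflection about the interface swaps the sides, negates \<open>w\<close> and all first derivatives, and
  hence keeps \<open>v\<close>.\<close>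

definition cut_residual ::
  "real \<Rightarrow> real \<Rightarrow> real \<Rightarrow> real \<Rightarrow> real \<Rightarrow> real \<Rightarrow> real \<Rightarrow> real \<Rightarrow> real \<Rightarrow> real \<Rightarrow> real \<Rightarrow> real \<Rightarrow> real"
  where "cut_residual h H B B' d d' w v u0 u1 u2 F =
    (B * (u1 - u0) - H * (u2 - u1)) / h\<^sup>2
      - ((d + h / 2) / h * F - H / h\<^sup>2 * (w + v / B' * d'))"

text \<open>The last identity is the reason for harmonic averaging: a function that is linear on both sides,
  continuous, and of continuous flux has its exact flux reproduced by the coefficient \<open>H\<close>.\<close>

lemma harmonic_mean_bounds:
  fixes h :: real
  assumes "0 < d" "0 < d'" "d + d' = h" "0 < B" "0 < B'"
    and H: "H = inverse (d / (B * h) + d' / (B' * h))"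
  shows "0 < H" and "H \<le> B + B'" and "H * (d + B * d' / B') = h * B"
proof -
  have h: "0 < h" using assms by linarith
  have pos: "0 < d * B' + d' * B" using assms by (simp add: add_pos_pos)
  have eq: "H = h * B * B' / (d * B' + d' * B)"
    unfolding H using assms h pos by (simp add: field_simps)
  show "0 < H" unfolding eq using assms h pos by simp
  have "h * B * B' = d * B * B' + d' * B * B'"
    unfolding assms(3)[symmetric] by (simp add: algebra_simps)
  also have "\<dots> \<le> (B + B') * (d * B' + d' * B)"
    using assms by (simp add: algebra_simps)
  finally show "H \<le> B + B'" unfolding eq using pos by (simp add: pos_divide_le_eq)
  show "H * (d + B * d' / B') = h * B"
  proof -
    have "d + B * d' / B' = (d * B' + d' * B) / B'" using assms(5) by (simp add: field_simps)
    then show ?thesis unfolding eq using pos assms(5) by simp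
  qed
qed

text \<open>The residual is affine in the Taylor remainders. Their exact coefficients show that only the
  term with \<open>H (q2 d'\<^sup>2 - p2 d\<^sup>2)\<close> survives without a remainder factor. The remainders of \<open>u\<close> are
  \<open>O(h\<^sup>3)\<close> and are divided by \<open>h\<^sup>2\<close>, that of the source is \<open>O(h)\<close>, so everything else is \<open>O(h)\<close>.
  The factor \<open>4\<close> is what the third-order remainder \<open>M t\<^sup>3 / 2\<close> yields at the farthest node,
  where \<open>t \<le> 2 h\<close>.\<close>

lemma cut_residual_expansion:
  fixes h :: real
  assumes d: "0 < d" "0 < d'" "d + d' = h" and B: "0 < B" "0 < B'"
    and H: "H = inverse (d / (B * h) + d' / (B' * h))"
    and u0: "\<bar>u0 - (p - p1 * (d + h) + p2 * (d + h)\<^sup>2 / 2)\<bar> \<le> 4 * M * h ^ 3"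
    and u1: "\<bar>u1 - (p - p1 * d + p2 * d\<^sup>2 / 2)\<bar> \<le> 4 * M * h ^ 3"
    and u2: "\<bar>u2 - (p + w + q1 * d' + q2 * d'\<^sup>2 / 2)\<bar> \<le> 4 * M * h ^ 3"
    and F: "\<bar>F + B * p2\<bar> \<le> B * (M * h)"
    and v: "v = B' * q1 - B * p1"
  shows "\<bar>cut_residual h H B B' d d' w v u0 u1 u2 F
            + H * (q2 * d'\<^sup>2 - p2 * d\<^sup>2) / (2 * h\<^sup>2)\<bar> \<le> 18 * (B + B') * M * h"
proof -
  define e0 where "e0 = u0 - (p - p1 * (d + h) + p2 * (d + h)\<^sup>2 / 2)"
  define e1 where "e1 = u1 - (p - p1 * d + p2 * d\<^sup>2 / 2)"
  define e2 where "e2 = u2 - (p + w + q1 * d' + q2 * d'\<^sup>2 / 2)"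
  define e3 where "e3 = F + B * p2"
  define E where "E = 4 * M * h ^ 3"
  have h: "0 < h" using d by linarith
  note hm = harmonic_mean_bounds[OF d B H]
  have M: "0 \<le> M * h" using order_trans[OF abs_ge_zero F] B by (simp add: zero_le_mult_iff)
  have E: "\<bar>e0\<bar> \<le> E" "\<bar>e1\<bar> \<le> E" "\<bar>e2\<bar> \<le> E"
    using u0 u1 u2 by (simp_all add: e0_def e1_def e2_def E_def)
  have E': "E / h\<^sup>2 = 4 * (M * h)" using h by (simp add: E_def field_simps eval_nat_numeral)
  \<comment> \<open>The difference across the interface after removal of the correction term.\<close>
  define J where "J = u2 - u1 - (w + v / B' * d')"
  have J: "J = p1 * (d + B * d' / B') + (q2 * d'\<^sup>2 - p2 * d\<^sup>2) / 2 + (e2 - e1)"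
    using B by (simp add: J_def e1_def e2_def v field_simps)
  have HJ: "H * J = h * B * p1 + H * (q2 * d'\<^sup>2 - p2 * d\<^sup>2) / 2 + H * (e2 - e1)"
    unfolding J hm(3)[symmetric] by (simp add: algebra_simps)
  have du: "u1 - u0 = p1 * h - p2 * h * (d + h / 2) + (e1 - e0)"
    by (simp add: e0_def e1_def field_simps power2_eq_square)
  have Feq: "F = e3 - B * p2" by (simp add: e3_def)
  have "cut_residual h H B B' d d' w v u0 u1 u2 F
      = (B * (u1 - u0) - H * J) / h\<^sup>2 - (d + h / 2) / h * F"
    using h by (simp add: cut_residual_def J_def field_simps)
  also have "\<dots> = - (H * (q2 * d'\<^sup>2 - p2 * d\<^sup>2) / (2 * h\<^sup>2))
      + (B * (e1 - e0) - H * (e2 - e1)) / h\<^sup>2 - (d + h / 2) / h * e3"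
    unfolding HJ du Feq using h by (simp add: field_simps power2_eq_square)
  finally have eq: "cut_residual h H B B' d d' w v u0 u1 u2 F
        + H * (q2 * d'\<^sup>2 - p2 * d\<^sup>2) / (2 * h\<^sup>2)
      = (B * (e1 - e0) - H * (e2 - e1)) / h\<^sup>2 - (d + h / 2) / h * e3" by simp
  have b1: "\<bar>B * (e1 - e0)\<bar> \<le> (B + B') * (2 * E)"
    unfolding abs_mult using E B by (intro mult_mono) auto
  have b2: "\<bar>H * (e2 - e1)\<bar> \<le> (B + B') * (2 * E)"
    unfolding abs_mult using E B hm by (intro mult_mono) auto
  have "\<bar>B * (e1 - e0) - H * (e2 - e1)\<bar> \<le> (B + B') * (4 * E)"
    using b1 b2 by argo
  then have "\<bar>(B * (e1 - e0) - H * (e2 - e1)) / h\<^sup>2\<bar> \<le> (B + B') * (4 * E) / h\<^sup>2"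
    unfolding abs_divide by (simp add: divide_right_mono)
  also have "\<dots> = 16 * ((B + B') * (M * h))"
    using E' by (simp flip: times_divide_eq_right)
  finally have c1: "\<bar>(B * (e1 - e0) - H * (e2 - e1)) / h\<^sup>2\<bar> \<le> 16 * ((B + B') * (M * h))" .
  have "\<bar>(d + h / 2) / h * e3\<bar> \<le> 2 * ((B + B') * (M * h))"
    unfolding abs_mult
  proof (rule mult_mono)
    show "\<bar>(d + h / 2) / h\<bar> \<le> 2" using d h by (simp add: pos_divide_le_eq)
    have "\<bar>e3\<bar> \<le> B * (M * h)" using F by (simp add: e3_def)
    also have "\<dots> \<le> (B + B') * (M * h)" using B M by (intro mult_right_mono) auto
    finally show "\<bar>e3\<bar> \<le> (B + B') * (M * h)" .
  qed auto
  with c1 have "\<bar>(B * (e1 - e0) - H * (e2 - e1)) / h\<^sup>2 - (d + h / 2) / h * e3\<bar>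
      \<le> 18 * ((B + B') * (M * h))" by argo
  then show ?thesis unfolding eq by (simp only: mult.assoc)
qed

lemma leading_term_bounded:
  fixes h :: real
  assumes "0 < d" "0 < d'" "d + d' = h" and "0 < H" "H \<le> K"
  shows "\<bar>H * (q2 * d'\<^sup>2 - p2 * d\<^sup>2) / (2 * h\<^sup>2)\<bar> \<le> K * (\<bar>p2\<bar> + \<bar>q2\<bar>)"
proof -
  have h: "0 < h" using assms by linarith
  have sq: "d\<^sup>2 \<le> h\<^sup>2" "d'\<^sup>2 \<le> h\<^sup>2" using assms by (auto intro: power_mono)
  have "\<bar>q2 * d'\<^sup>2 - p2 * d\<^sup>2\<bar> \<le> \<bar>q2\<bar> * d'\<^sup>2 + \<bar>p2\<bar> * d\<^sup>2"
    using abs_triangle_ineq4[of "q2 * d'\<^sup>2" "p2 * d\<^sup>2"] by (simp add: abs_mult)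
  also have "\<dots> \<le> \<bar>q2\<bar> * h\<^sup>2 + \<bar>p2\<bar> * h\<^sup>2"
    using sq by (intro add_mono mult_left_mono) auto
  finally have "\<bar>H * (q2 * d'\<^sup>2 - p2 * d\<^sup>2)\<bar> \<le> K * ((\<bar>p2\<bar> + \<bar>q2\<bar>) * h\<^sup>2)"
    unfolding abs_mult using assms by (intro mult_mono) (auto simp: algebra_simps)
  also have "\<dots> \<le> K * (\<bar>p2\<bar> + \<bar>q2\<bar>) * (2 * h\<^sup>2)"
    using assms by (simp add: mult_ac)
  finally show ?thesis using h by (simp add: abs_divide pos_divide_le_eq)
qed

section \<open>Truncation errors as residuals\<close>

text \<open>Here the boundary conditions enter: the zero extension of the grid values of \<open>u\<close> agrees with
  \<open>u\<close> at all nodes, including \<open>a\<close> and \<open>b\<close>, so that the stencil needs no special case when the cut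
  interval is close to the boundary.\<close>

lemma trunc_err_at_cut:
  fixes a b \<alpha> \<beta>m \<beta>p w v :: real and f u :: "real \<Rightarrow> real" and n :: nat
  assumes "a < b" and cut: "is_cut_index a b \<alpha> n (cut_index a b \<alpha> n)"
    and u: "u a = 0" "u b = 0"
  defines "i \<equiv> cut_index a b \<alpha> n" and "h \<equiv> mesh a b n" and "x \<equiv> node a b n"
    and "d \<equiv> delta_l a b \<alpha> n" and "d' \<equiv> delta_r a b \<alpha> n" and "H \<equiv> beta_H a b \<alpha> \<beta>m \<beta>p n"
  shows "0 < h" "0 < d" "0 < d'" "d + d' = h"
    and "x (i - 1) = \<alpha> - (d + h)" "x i = \<alpha> - d" "x (i + 1) = \<alpha> + d'" "x (i + 2) = \<alpha> + (d' + h)"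
    and "a \<le> x (i - 1)" "x (i + 2) \<le> b"
    and "trunc_err a b \<alpha> \<beta>m \<beta>p w v f u n i
      = cut_residual h H \<beta>m \<beta>p d d' w v (u (x (i - 1))) (u (x i)) (u (x (i + 1))) (f (x i))"
    and "trunc_err a b \<alpha> \<beta>m \<beta>p w v f u n (i + 1)
      = cut_residual h H \<beta>p \<beta>m d' d (- w) v (u (x (i + 2))) (u (x (i + 1))) (u (x i)) (f (x (i + 1)))"
proof -
  have i: "1 \<le> i" "i + 1 \<le> n" "x i < \<alpha>" "\<alpha> < x (i + 1)"
    using cut by (auto simp: is_cut_index_def i_def x_def)
  show h: "0 < h" using assms(1) by (simp add: h_def mesh_def)
  show d: "0 < d" "0 < d'" using i by (auto simp: d_def d'_def delta_l_def delta_r_def i_def x_def)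
  have step: "x (j + 1) = x j + h" for j by (simp add: x_def node_def h_def algebra_simps)
  have ends: "x 0 = a" "x (n + 1) = b"
    using assms(1) by (simp_all add: x_def node_def mesh_def add.commute)
  show sum: "d + d' = h"
    using step[of i] by (simp add: d_def d'_def delta_l_def delta_r_def i_def x_def)
  show xi: "x i = \<alpha> - d" "x (i + 1) = \<alpha> + d'"
    by (simp_all add: d_def d'_def delta_l_def delta_r_def i_def x_def)
  show "x (i - 1) = \<alpha> - (d + h)" using step[of "i - 1"] i xi by simp
  show "x (i + 2) = \<alpha> + (d' + h)" using step[of "i + 1"] xi by simp
  have mono: "x j \<le> x k" if "j \<le> k" for j k
    using that h by (simp add: x_def node_def h_def)
  show "a \<le> x (i - 1)" using mono[of 0 "i - 1"] ends by simp
  show "x (i + 2) \<le> b" using mono[of "i + 2" "n + 1"] ends i by simp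
  have V: "zero_ext n (\<lambda>j. u (x j)) j = u (x j)" if "j \<le> n + 1" for j
  proof (cases "1 \<le> j \<and> j \<le> n")
    case False
    then have "j = 0 \<or> j = n + 1" using that by linarith
    then show ?thesis using ends u False by (auto simp: zero_ext_def)
  qed (simp add: zero_ext_def)
  have hl: "h_l a b \<alpha> n = d + h / 2" "h_r a b \<alpha> n = d' + h / 2"
    by (simp_all add: h_l_def h_r_def d_def d'_def h_def)
  have ne: "d + h / 2 \<noteq> 0" "d' + h / 2 \<noteq> 0" "h \<noteq> 0" using d h by linarith+
  have beta: "face_coeff a b \<alpha> \<beta>m \<beta>p n (i - 1) = \<beta>m" "face_coeff a b \<alpha> \<beta>m \<beta>p n i = H"
      "face_coeff a b \<alpha> \<beta>m \<beta>p n (i + 1) = \<beta>p"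
    using i by (auto simp: face_coeff_def i_def H_def)
  have corr: "(d + h / 2) / h * (F + - (H / ((d + h / 2) * h)) * k)
        = (d + h / 2) / h * F - H / h\<^sup>2 * k"
      "(d' + h / 2) / h * (F + H / ((d' + h / 2) * h) * k)
        = (d' + h / 2) / h * F - H / h\<^sup>2 * (- k)" for F k
    using ne by (simp_all add: divide_simps power2_eq_square)
  have rhs: "scheme_rhs a b \<alpha> \<beta>m \<beta>p w v f n i
        = (d + h / 2) / h * f (x i) - H / h\<^sup>2 * (w + v / \<beta>p * d')"
      "scheme_rhs a b \<alpha> \<beta>m \<beta>p w v f n (i + 1)
        = (d' + h / 2) / h * f (x (i + 1)) - H / h\<^sup>2 * (- (w - v / \<beta>m * d))"
    unfolding corr[symmetric]
    by (simp_all add: scheme_rhs_def corr_l_def corr_r_def hl Let_def i_def[symmetric] h_def[symmetric]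
        H_def[symmetric] x_def[symmetric] d_def[symmetric] d'_def[symmetric])
  show "trunc_err a b \<alpha> \<beta>m \<beta>p w v f u n i
      = cut_residual h H \<beta>m \<beta>p d d' w v (u (x (i - 1))) (u (x i)) (u (x (i + 1))) (f (x i))"
    unfolding trunc_err_def discrete_op_def Let_def rhs cut_residual_def beta x_def[symmetric]
      h_def[symmetric]
    using i by (simp add: V add_divide_distrib diff_divide_distrib algebra_simps)
  have "i + 1 - 1 = i" "i + 1 + 1 = i + 2" by simp_all
  then show "trunc_err a b \<alpha> \<beta>m \<beta>p w v f u n (i + 1)
      = cut_residual h H \<beta>p \<beta>m d' d (- w) v (u (x (i + 2))) (u (x (i + 1))) (u (x i)) (f (x (i + 1)))"
    unfolding trunc_err_def discrete_op_def Let_def rhs cut_residual_def x_def[symmetric]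
      h_def[symmetric] using i beta by (simp add: V add_divide_distrib diff_divide_distrib algebra_simps)
qed

section \<open>Boundedness and cancellation\<close>

theorem lemma4p2:
  fixes a b \<alpha> \<beta>m \<beta>p w v :: real and f u :: "real \<Rightarrow> real"
  defines "x \<equiv> node a b" and "I \<equiv> cut_index a b \<alpha>" and "\<tau> \<equiv> trunc_err a b \<alpha> \<beta>m \<beta>p w v f u"
  assumes "a < \<alpha>" and "\<alpha> < b" and "\<beta>m > 0" and "\<beta>p > 0"
    and "solves_interface_problem a b \<alpha> \<beta>m \<beta>p w v f u"
    and "\<forall>\<^sub>F n in interface_grids a b \<alpha>. C_class_on 3 {x n (I n - 1)..\<alpha>} (left_branch \<alpha> u)"
    and "\<forall>\<^sub>F n in interface_grids a b \<alpha>. C_class_on 3 {\<alpha>..x n (I n + 2)} (right_branch \<alpha> u)"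
  shows "(\<lambda>n. \<tau> n (I n)) \<in> O[interface_grids a b \<alpha>](\<lambda>n. 1) \<and>
         (\<lambda>n. \<tau> n (I n + 1)) \<in> O[interface_grids a b \<alpha>](\<lambda>n. 1) \<and>
         (\<lambda>n. \<tau> n (I n) + \<tau> n (I n + 1)) \<in> O[interface_grids a b \<alpha>](\<lambda>n. mesh a b n)"
proof -
  let ?F = "interface_grids a b \<alpha>"
  let ?flux = "\<lambda>y. pw_coeff \<alpha> \<beta>m \<beta>p y * deriv u y"
  note \<beta> = \<open>\<beta>m > 0\<close> \<open>\<beta>p > 0\<close>
  have ab: "a < b" using assms by linarith
  have ode: "\<And>y. y \<in> {a<..<\<alpha>} \<union> {\<alpha><..<b} \<Longrightarrow> (?flux has_real_derivative - f y) (at y)"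
    and bc: "u a = 0" "u b = 0" and jump: "has_jump u \<alpha> w" "has_jump ?flux \<alpha> v"
    using assms(8) unfolding solves_interface_problem_def by blast+
  have adm: "\<forall>\<^sub>F n in ?F. is_cut_index a b \<alpha> n (I n)"
    unfolding interface_grids_def eventually_inf_principal I_def
    using is_cut_index_cut_index[OF ab] by (intro always_eventually) blast
  note geo = trunc_err_at_cut[where \<alpha> = \<alpha> and u = u, OF ab _ bc, folded I_def]
  obtain n0 where n0: "is_cut_index a b \<alpha> n0 (I n0)"
      "C_class_on 3 {x n0 (I n0 - 1)..\<alpha>} (left_branch \<alpha> u)"
      "C_class_on 3 {\<alpha>..x n0 (I n0 + 2)} (right_branch \<alpha> u)"
    using eventually_happens'[OF interface_grids_nontrivial
        eventually_conj[OF adm eventually_conj[OF assms(9,10)]]] assms(4,5) by blast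
  \<comment> \<open>One grid fixes the neighbourhood of the interface: the outer nodes of its stencil are farther
    than its mesh width \<open>e\<close> from \<open>\<alpha>\<close>.\<close>
  define e where "e = mesh a b n0"
  note g0 = geo[OF n0(1), folded x_def e_def]
  have e: "0 < e" "x n0 (I n0 - 1) < \<alpha> - e" "\<alpha> + e < x n0 (I n0 + 2)" "a < \<alpha> - e" "\<alpha> + e < b"
    using g0(1-10) by linarith+
  define SL SR where "SL = {\<alpha> - e..\<alpha>}" and "SR = {\<alpha>..\<alpha> + e}"
  define TL TR where "TL = {\<alpha> - e<..<\<alpha>}" and "TR = {\<alpha><..<\<alpha> + e}"
  note sets = SL_def SR_def TL_def TR_def
  obtain P CL where P0: "\<forall>y\<in>SL. P 0 y = left_branch \<alpha> u y"
    and P: "\<forall>j<3. \<forall>y\<in>SL. (P j has_real_derivative P (Suc j) y) (at y within SL)"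
    and CL: "\<forall>y\<in>SL. \<bar>P 3 y\<bar> \<le> CL"
    by (rule C3_bounded_data[OF n0(2), of SL]) (use e in \<open>auto simp: sets\<close>)
  obtain Q CR where Q0: "\<forall>y\<in>SR. Q 0 y = right_branch \<alpha> u y"
    and Q: "\<forall>j<3. \<forall>y\<in>SR. (Q j has_real_derivative Q (Suc j) y) (at y within SR)"
    and CR: "\<forall>y\<in>SR. \<bar>Q 3 y\<bar> \<le> CR"
    by (rule C3_bounded_data[OF n0(3), of SR]) (use e in \<open>auto simp: sets\<close>)
  define M where "M = max CL CR"
  have TL: "open TL" "TL \<subseteq> SL" "\<alpha> \<in> SL" "convex SL"
    and TR: "open TR" "TR \<subseteq> SR" "\<alpha> \<in> SR" "convex SR"
    using e by (auto simp: sets)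
  have at: "at \<alpha> within TL = at_left \<alpha>" "at \<alpha> within TR = at_right \<alpha>"
    by (rule at_within_nhd[of \<alpha> "{\<alpha> - e<..<\<alpha> + e}"]; use e in \<open>auto simp: sets\<close>)+
  have uP: "\<forall>y\<in>TL. P 0 y = u y" and cP: "\<forall>y\<in>TL. pw_coeff \<alpha> \<beta>m \<beta>p y = \<beta>m"
    using P0 TL(2) by (auto simp: left_branch_def pw_coeff_def TL_def)
  have uQ: "\<forall>y\<in>TR. Q 0 y = u y" and cQ: "\<forall>y\<in>TR. pw_coeff \<alpha> \<beta>m \<beta>p y = \<beta>p"
    using Q0 TR(2) by (auto simp: right_branch_def pw_coeff_def TR_def)
  note limL = branch_limits[OF P TL(1,2,3) uP cP, unfolded at]
  note limR = branch_limits[OF Q TR(1,2,3) uQ cQ, unfolded at]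
  have w: "Q 0 \<alpha> = P 0 \<alpha> + w"
    by (rule jump_of_limits[OF jump(1) limL(1) limR(1)])
  have v: "v = \<beta>p * Q 1 \<alpha> - \<beta>m * P 1 \<alpha>"
    using jump_of_limits[OF jump(2) limL(2) limR(2)] by simp
  have fL: "f y = - \<beta>m * P 2 y" if y: "y \<in> TL" for y
    by (rule source_on_branch[OF P TL(1,2) uP cP y ode]) (use y e in \<open>auto simp: TL_def\<close>)
  have fR: "f y = - \<beta>p * Q 2 y" if y: "y \<in> TR" for y
    by (rule source_on_branch[OF Q TR(1,2) uQ cQ y ode]) (use y e in \<open>auto simp: TR_def\<close>)

  define T where "T n = beta_H a b \<alpha> \<beta>m \<beta>p n
      * (Q 2 \<alpha> * (delta_r a b \<alpha> n)\<^sup>2 - P 2 \<alpha> * (delta_l a b \<alpha> n)\<^sup>2) / (2 * (mesh a b n)\<^sup>2)" for n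
  define K where "K = 18 * (\<beta>m + \<beta>p) * M"
  define L where "L = (\<beta>m + \<beta>p) * (\<bar>P 2 \<alpha>\<bar> + \<bar>Q 2 \<alpha>\<bar>)"
  \<comment> \<open>The farthest stencil nodes have distance less than \<open>2 h\<close> from \<open>\<alpha>\<close>.\<close>
  have main: "\<bar>\<tau> n (I n) + T n\<bar> \<le> K * mesh a b n \<and> \<bar>\<tau> n (I n + 1) - T n\<bar> \<le> K * mesh a b n \<and> \<bar>T n\<bar> \<le> L"
    if cut: "is_cut_index a b \<alpha> n (I n)" and small: "2 * mesh a b n < e" for n
  proof -
    define h d d' H where "h = mesh a b n" and "d = delta_l a b \<alpha> n" and "d' = delta_r a b \<alpha> n"
      and "H = beta_H a b \<alpha> \<beta>m \<beta>p n"
    note g = geo[OF cut, folded x_def h_def d_def d'_def \<tau>_def]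
    have H: "H = inverse (d / (\<beta>m * h) + d' / (\<beta>p * h))"
      by (simp add: H_def beta_H_def d_def d'_def h_def)
    have Tn: "T n = H * (Q 2 \<alpha> * d'\<^sup>2 - P 2 \<alpha> * d\<^sup>2) / (2 * h\<^sup>2)"
      by (simp add: T_def H_def d_def d'_def h_def)
    note tau = g(11)[of \<beta>m \<beta>p w v f, folded \<tau>_def H_def, unfolded g(5-8)]
      g(12)[of \<beta>m \<beta>p w v f, folded \<tau>_def H_def, unfolded g(5-8)]
    have H': "H = inverse (d' / (\<beta>p * h) + d / (\<beta>m * h))" unfolding H by (simp add: add.commute)
    have M0: "0 \<le> M" using bspec[OF CL TL(3)] by (simp add: M_def)
    have cube: "M * t ^ 3 / 2 \<le> 4 * M * h ^ 3" if "0 \<le> t" "t \<le> 2 * h" for t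
    proof -
      have "M * t ^ 3 \<le> M * (2 * h) ^ 3" using that M0 by (intro mult_left_mono power_mono)
      then show ?thesis by (simp add: power_mult_distrib)
    qed
    have left: "\<bar>u (\<alpha> - t) - (P 0 \<alpha> - P 1 \<alpha> * t + P 2 \<alpha> * t\<^sup>2 / 2)\<bar> \<le> 4 * M * h ^ 3"
      if "0 < t" "t \<le> 2 * h" for t
    proof -
      have T: "\<alpha> + - t \<in> TL" using that small by (auto simp: TL_def h_def)
      have "\<bar>P 0 (\<alpha> + - t) - (P 0 \<alpha> + P 1 \<alpha> * - t + P 2 \<alpha> * (- t)\<^sup>2 / 2)\<bar> \<le> M * \<bar>- t\<bar> ^ 3 / 2"
        by (rule branch_taylor(1)[OF P TL(4)]) (use CL T TL in \<open>force simp: M_def\<close>)+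
      then show ?thesis using cube[of t] that bspec[OF uP T] by simp
    qed
    have right: "\<bar>u (\<alpha> + t) - (Q 0 \<alpha> + Q 1 \<alpha> * t + Q 2 \<alpha> * t\<^sup>2 / 2)\<bar> \<le> 4 * M * h ^ 3"
      if "0 < t" "t \<le> 2 * h" for t
    proof -
      have T: "\<alpha> + t \<in> TR" using that small by (auto simp: TR_def h_def)
      have "\<bar>Q 0 (\<alpha> + t) - (Q 0 \<alpha> + Q 1 \<alpha> * t + Q 2 \<alpha> * t\<^sup>2 / 2)\<bar> \<le> M * \<bar>t\<bar> ^ 3 / 2"
        by (rule branch_taylor(1)[OF Q TR(4)]) (use CR T TR in \<open>force simp: M_def\<close>)+
      then show ?thesis using cube[of t] that bspec[OF uQ T] by simp
    qed
    have dT: "\<alpha> + - d \<in> TL" "\<alpha> + d' \<in> TR" and dh: "d \<le> h" "d' \<le> h"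
      using g(1-4) small by (auto simp: TL_def TR_def h_def)
    have "\<bar>P 2 (\<alpha> + - d) - P 2 \<alpha>\<bar> \<le> M * \<bar>- d\<bar>"
      by (rule branch_taylor(2)[OF P TL(4)]) (use CL dT TL in \<open>force simp: M_def\<close>)+
    also have "\<dots> \<le> M * h" using M0 dh g(2) by (intro mult_left_mono) auto
    finally have P2: "\<bar>P 2 (\<alpha> + - d) - P 2 \<alpha>\<bar> \<le> M * h" .
    have "f (\<alpha> - d) + \<beta>m * P 2 \<alpha> = - (\<beta>m * (P 2 (\<alpha> + - d) - P 2 \<alpha>))"
      using fL[OF dT(1)] by (simp add: algebra_simps)
    then have FL: "\<bar>f (\<alpha> - d) + \<beta>m * P 2 \<alpha>\<bar> \<le> \<beta>m * (M * h)"
      using mult_left_mono[OF P2, of \<beta>m] \<beta> by (simp add: abs_mult)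
    have "\<bar>Q 2 (\<alpha> + d') - Q 2 \<alpha>\<bar> \<le> M * \<bar>d'\<bar>"
      by (rule branch_taylor(2)[OF Q TR(4)]) (use CR dT TR in \<open>force simp: M_def\<close>)+
    also have "\<dots> \<le> M * h" using M0 dh g(3) by (intro mult_left_mono) auto
    finally have Q2: "\<bar>Q 2 (\<alpha> + d') - Q 2 \<alpha>\<bar> \<le> M * h" .
    have "f (\<alpha> + d') + \<beta>p * Q 2 \<alpha> = - (\<beta>p * (Q 2 (\<alpha> + d') - Q 2 \<alpha>))"
      using fR[OF dT(2)] by (simp add: algebra_simps)
    then have FR: "\<bar>f (\<alpha> + d') + \<beta>p * Q 2 \<alpha>\<bar> \<le> \<beta>p * (M * h)"
      using mult_left_mono[OF Q2, of \<beta>p] \<beta> by (simp add: abs_mult)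
    \<comment> \<open>The node left of the interface, and then its mirror image, whose first derivatives change
      sign under the reflection.\<close>
    have "\<bar>cut_residual h H \<beta>m \<beta>p d d' w v (u (\<alpha> - (d + h))) (u (\<alpha> - d)) (u (\<alpha> + d')) (f (\<alpha> - d))
        + H * (Q 2 \<alpha> * d'\<^sup>2 - P 2 \<alpha> * d\<^sup>2) / (2 * h\<^sup>2)\<bar> \<le> 18 * (\<beta>m + \<beta>p) * M * h"
      by (rule cut_residual_expansion[OF g(2-4) \<beta> H left left right[unfolded w] FL v])
         (use g(1-4) dh in auto)
    moreover have "\<bar>cut_residual h H \<beta>p \<beta>m d' d (- w) v (u (\<alpha> + (d' + h))) (u (\<alpha> + d')) (u (\<alpha> - d))
          (f (\<alpha> + d'))
        + H * (P 2 \<alpha> * d\<^sup>2 - Q 2 \<alpha> * d'\<^sup>2) / (2 * h\<^sup>2)\<bar> \<le> 18 * (\<beta>p + \<beta>m) * M * h"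
    proof (rule cut_residual_expansion[where p = "Q 0 \<alpha>" and ?p1.0 = "- Q 1 \<alpha>" and ?q1.0 = "- P 1 \<alpha>",
          OF g(3,2) _ \<beta>(2,1) H' _ _ _ FR])
      show "d' + d = h" using g(4) by simp
      show "\<bar>u (\<alpha> + (d' + h)) - (Q 0 \<alpha> - - Q 1 \<alpha> * (d' + h) + Q 2 \<alpha> * (d' + h)\<^sup>2 / 2)\<bar> \<le> 4 * M * h ^ 3"
        using right[of "d' + h"] g(1-4) dh by simp
      show "\<bar>u (\<alpha> + d') - (Q 0 \<alpha> - - Q 1 \<alpha> * d' + Q 2 \<alpha> * d'\<^sup>2 / 2)\<bar> \<le> 4 * M * h ^ 3"
        using right[of d'] g(1-4) dh by simp
      show "\<bar>u (\<alpha> - d) - (Q 0 \<alpha> + - w + - P 1 \<alpha> * d + P 2 \<alpha> * d\<^sup>2 / 2)\<bar> \<le> 4 * M * h ^ 3"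
        using left[of d] g(1-4) dh w by simp
      show "v = \<beta>m * - P 1 \<alpha> - \<beta>p * - Q 1 \<alpha>" using v by simp
    qed
    moreover have "H * (P 2 \<alpha> * d\<^sup>2 - Q 2 \<alpha> * d'\<^sup>2) / (2 * h\<^sup>2) = - T n"
      unfolding Tn minus_divide_left mult_minus_right[symmetric] minus_diff_eq ..
    moreover have "\<bar>T n\<bar> \<le> L"
      unfolding Tn L_def
      by (rule leading_term_bounded[OF g(2-4) harmonic_mean_bounds(1,2)[OF g(2-4) \<beta> H]])
    ultimately show ?thesis
      unfolding tau Tn[symmetric] h_def[symmetric] K_def by (simp add: add.commute)
  qed
  have "(\<lambda>n. mesh a b n) \<longlonglongrightarrow> 0"
    using tendsto_mult_right_zero[OF LIMSEQ_inverse_real_of_nat, of "b - a"]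
    by (simp add: mesh_def divide_inverse add.commute)
  then have "\<forall>\<^sub>F n in at_top. mesh a b n < min 1 (e / 2)"
    by (rule order_tendstoD(2)) (use e in simp)
  then have "\<forall>\<^sub>F n in ?F. mesh a b n < min 1 (e / 2)"
    unfolding interface_grids_def eventually_inf_principal by (rule eventually_mono) simp
  then have ev: "\<forall>\<^sub>F n in ?F. \<bar>\<tau> n (I n) + T n\<bar> \<le> K * mesh a b n
      \<and> \<bar>\<tau> n (I n + 1) - T n\<bar> \<le> K * mesh a b n \<and> \<bar>T n\<bar> \<le> L \<and> 0 < mesh a b n \<and> mesh a b n < 1"
    using adm
  proof eventually_elim
    case (elim n)
    moreover have "0 < mesh a b n" using ab by (simp add: mesh_def)
    ultimately show ?case using main[of n] by simp
  qed
  have "\<forall>\<^sub>F n in ?F. \<bar>\<tau> n (I n)\<bar> \<le> \<bar>K\<bar> + L \<and> \<bar>\<tau> n (I n + 1)\<bar> \<le> \<bar>K\<bar> + L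
      \<and> \<bar>\<tau> n (I n) + \<tau> n (I n + 1)\<bar> \<le> 2 * K * mesh a b n"
    using ev
  proof eventually_elim
    case (elim n)
    have "K * mesh a b n \<le> \<bar>K\<bar> * 1" using elim by (intro mult_mono) auto
    then show ?case using elim by (simp add: abs_le_iff)
  qed
  moreover have "\<forall>\<^sub>F n in ?F. 0 < mesh a b n" using ev by (rule eventually_mono) simp
  ultimately have "\<forall>\<^sub>F n in ?F. \<bar>\<tau> n (I n)\<bar> \<le> \<bar>K\<bar> + L \<and> \<bar>\<tau> n (I n + 1)\<bar> \<le> \<bar>K\<bar> + L
      \<and> \<bar>\<tau> n (I n) + \<tau> n (I n + 1)\<bar> \<le> 2 * K * \<bar>mesh a b n\<bar>"
    by eventually_elim simp
  then show ?thesis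
    by (intro conjI bigoI[of _ "\<bar>K\<bar> + L"] bigoI[of _ "2 * K"]; elim eventually_mono; simp)
qed

end
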